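(* Let $t$ be a positive integer and $G=(A\dot\cup B,E)$ a bipartite graph with $|A|\le|B|\le t|A|$. Let $\delta_A$ (respectively $\delta_B$) be the minimum degree of the vertices in $A$ (respectively $B$). If $t\delta_A+\delta_B\ge|A|$ and $\delta_A+t\delta_B\ge|B|$, then $G$ has a $t$-shallow hitting edge set.
   Context: Graphs may have parallel edges. For an edge set $M\subseteq E$, $\deg_M(v)$ is the number of edges of $M$ incident to $v$; $M$ is hitting if $\deg_M(v)\ge1$ for every vertex $v$, and $t$-shallow if $\deg_M(v)\le t$ for every vertex $v$.
   Formalization: The minimum degrees δ_A and δ_B count parallel edges only once (number of distinct neighbours); counted with multiplicity the claim is false, e.g. t=1, |A|=|B|=2, both vertices of A joined by double edges to the same vertex of B. *)

theory Defs
  imports Main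
begin

text \<open>Graphs are finite and loopless and may have parallel edges: the edges are abstract objects,
  and \<open>ends e\<close> is the two-element set of end vertices of the edge \<open>e\<close>.\<close>

locale multigraph =
  fixes V :: "'v set" and E :: "'e set" and ends :: "'e \<Rightarrow> 'v set"
  assumes finite_vertices: "finite V"
    and finite_edges: "finite E"
    and ends_subset: "e \<in> E \<Longrightarrow> ends e \<subseteq> V"
    and card_ends: "e \<in> E \<Longrightarrow> card (ends e) = 2"

locale bipartite_multigraph = multigraph "A \<union> B" E ends
  for A B :: "'v set" and E :: "'e set" and ends :: "'e \<Rightarrow> 'v set" +
  assumes disjoint_parts: "A \<inter> B = {}"
    and edge_meets_parts: "e \<in> E \<Longrightarrow> ends e \<inter> A \<noteq> {} \<and> ends e \<inter> B \<noteq> {}"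

definition deg :: "('e \<Rightarrow> 'v set) \<Rightarrow> 'e set \<Rightarrow> 'v \<Rightarrow> nat" where
  "deg ends M v = card {e \<in> M. v \<in> ends e}"

definition hitting :: "('e \<Rightarrow> 'v set) \<Rightarrow> 'v set \<Rightarrow> 'e set \<Rightarrow> bool" where
  "hitting ends V M \<longleftrightarrow> (\<forall>v\<in>V. 1 \<le> deg ends M v)"

definition shallow :: "nat \<Rightarrow> ('e \<Rightarrow> 'v set) \<Rightarrow> 'v set \<Rightarrow> 'e set \<Rightarrow> bool" where
  "shallow t ends V M \<longleftrightarrow> (\<forall>v\<in>V. deg ends M v \<le> t)"

text \<open>The degree used for minimum degrees counts a bundle of parallel edges once, i.e. it is the
  degree in the underlying simple graph.  Without parallel edges it agrees with \<^const>\<open>deg\<close>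
  (lemma \<open>simple_deg_eq_deg\<close>); with parallel edges counted separately, the minimum-degree
  condition would not suffice (lemma \<open>parallel_edges_counterexample\<close>).\<close>

definition simple_deg :: "('e \<Rightarrow> 'v set) \<Rightarrow> 'e set \<Rightarrow> 'v \<Rightarrow> nat" where
  "simple_deg ends E v = card {u. \<exists>e\<in>E. ends e = {u, v}}"

text \<open>Only meaningful for finite nonempty \<open>S\<close>.\<close>

definition min_degree :: "('e \<Rightarrow> 'v set) \<Rightarrow> 'e set \<Rightarrow> 'v set \<Rightarrow> nat" where
  "min_degree ends E S = Min (simple_deg ends E ` S)"

lemma (in multigraph) simple_deg_eq_deg:
  assumes "inj_on ends E"
  shows "simple_deg ends E v = deg ends E v"
proof -
  let ?N = "{u. \<exists>e\<in>E. ends e = {u, v}}" and ?I = "{e \<in> E. v \<in> ends e}"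
  have "\<exists>u. ends e = {u, v}" if e: "e \<in> ?I" for e
  proof -
    obtain x y where xy: "ends e = {x, y}"
      using e card_ends[of e] by (auto simp: card_2_iff)
    with e have "v = x \<or> v = y" by simp
    then show ?thesis
    proof
      assume "v = x"
      then have "ends e = {y, v}" using xy by (simp add: insert_commute)
      then show ?thesis ..
    next
      assume "v = y"
      then show ?thesis using xy by (intro exI[of _ x]) simp
    qed
  qed
  then have "ends ` ?I \<subseteq> (\<lambda>u. {u, v}) ` ?N" by blast
  moreover have "(\<lambda>u. {u, v}) ` ?N \<subseteq> ends ` ?I"
  proof (rule image_subsetI)
    fix u assume "u \<in> ?N"
    then obtain e where "e \<in> E" "ends e = {u, v}" by blast
    then show "{u, v} \<in> ends ` ?I" by (intro rev_image_eqI[of e]) simp_all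
  qed
  ultimately have eq: "(\<lambda>u. {u, v}) ` ?N = ends ` ?I" by (rule equalityI[rotated])
  have "card ?N = card ((\<lambda>u. {u, v}) ` ?N)"
    by (rule card_image[symmetric]) (auto simp: inj_on_def doubleton_eq_iff)
  also have "\<dots> = card (ends ` ?I)" by (simp only: eq)
  also have "\<dots> = card ?I"
    by (rule card_image, rule inj_on_subset[OF assms]) blast
  finally have "card ?N = card ?I" .
  then show ?thesis by (simp add: simple_deg_def deg_def)
qed

lemma parallel_edges_counterexample:
  fixes A B E :: "nat set" and ends :: "nat \<Rightarrow> nat set" and t :: nat
  defines "A \<equiv> {0, 1}" and "B \<equiv> {2, 3}" and "E \<equiv> {0, 1, 2, 3}" and "t \<equiv> 1"
    and "ends \<equiv> \<lambda>e. if e < 2 then {0, 2} else {1, 2}"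
  shows "bipartite_multigraph A B E ends"
    and "card A \<le> card B" and "card B \<le> t * card A"
    and "card A \<le> t * Min (deg ends E ` A) + Min (deg ends E ` B)"
    and "card B \<le> Min (deg ends E ` A) + t * Min (deg ends E ` B)"
    and "\<not> (\<exists>M\<subseteq>E. hitting ends (A \<union> B) M \<and> shallow t ends (A \<union> B) M)"
proof -
  show "bipartite_multigraph A B E ends"
  proof unfold_locales
    fix e
    have "ends e = {0, 2} \<or> ends e = {1, 2}" by (simp add: ends_def)
    then show "ends e \<subseteq> A \<union> B" "card (ends e) = 2" "ends e \<inter> A \<noteq> {} \<and> ends e \<inter> B \<noteq> {}"
      by (elim disjE; simp add: A_def B_def)+
  qed (simp_all add: A_def B_def E_def)
  have "{e \<in> E. 0 \<in> ends e} = {0, 1}" "{e \<in> E. 1 \<in> ends e} = {2, 3}"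
    by (auto simp: E_def ends_def)
  then have "deg ends E 0 = 2" "deg ends E 1 = 2" by (simp_all add: deg_def)
  then have "Min (deg ends E ` A) = 2" by (simp add: A_def)
  then show "card A \<le> t * Min (deg ends E ` A) + Min (deg ends E ` B)"
    and "card B \<le> Min (deg ends E ` A) + t * Min (deg ends E ` B)"
    by (simp_all add: A_def B_def t_def)
  show "card A \<le> card B" "card B \<le> t * card A" by (simp_all add: A_def B_def t_def)
  have "{e \<in> M. 3 \<in> ends e} = {}" for M by (auto simp: ends_def)
  then have "deg ends M 3 = 0" for M unfolding deg_def by (metis card.empty)
  then show "\<not> (\<exists>M\<subseteq>E. hitting ends (A \<union> B) M \<and> shallow t ends (A \<union> B) M)"
    by (auto simp: hitting_def B_def)
qed

end

theory Submission
  imports Defs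
begin

text \<open>
  The degree conditions give the Hall-type condition that every set \<open>S\<close> contained in one part has at
  least \<open>|S| / t\<close> neighbours.  Starting from the hitting set \<open>E\<close>, the degrees on one side are
  brought down to \<open>t\<close> by alternating exchanges: while a vertex \<open>x\<close> has degree above \<open>t\<close>, follow
  alternating paths from \<open>x\<close> until a vertex of degree less than \<open>t\<close> or an edge whose other end
  is hit twice is met; if this never happens, the vertices without an exit contradict the Hall-type
  condition.  Such exchanges never increase a degree on the other side, so the two sides can be
  treated one after the other.
\<close>

text \<open>\<open>p\<close> sends an edge to its end in one part and \<open>q\<close> to its end in
  the other. With edges described by two such maps, each lemma serves both parts by swapping
  \<open>p\<close> and \<open>q\<close>.\<close>

definition load :: "('e \<Rightarrow> 'a) \<Rightarrow> 'e set \<Rightarrow> 'a \<Rightarrow> nat" where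
  "load p M x = card {e \<in> M. p e = x}"

text \<open>Truncated subtraction lets only vertices above \<open>t\<close> contribute. This number
  is the measure that decreases while one side is made shallow.\<close>

definition excess :: "('e \<Rightarrow> 'a) \<Rightarrow> 'e set \<Rightarrow> nat \<Rightarrow> 'e set \<Rightarrow> nat" where
  "excess p E t M = (\<Sum>x\<in>p ` E. load p M x - t)"

text \<open>The vertices that have an alternating path with at most \<open>n\<close> exchanges to an exit.\<close>

primrec relievable ::
    "('e \<Rightarrow> 'a) \<Rightarrow> ('e \<Rightarrow> 'b) \<Rightarrow> 'e set \<Rightarrow> nat \<Rightarrow> 'e set \<Rightarrow> nat \<Rightarrow> 'a set" where
  "relievable p q E t M 0 = {x. load p M x < t \<or> (\<exists>e\<in>M. p e = x \<and> 2 \<le> load q M (q e))}"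
| "relievable p q E t M (Suc n) = relievable p q E t M n \<union>
     {x. \<exists>e\<in>M. \<exists>f\<in>E. p e = x \<and> q f = q e \<and> p f \<in> relievable p q E t M n}"

section \<open>Loads after insertion, removal and exchange of edges\<close>

lemma load_pos_iff: "finite M \<Longrightarrow> 0 < load p M x \<longleftrightarrow> x \<in> p ` M"
  by (auto simp: load_def card_gt_0_iff)

lemma load_insert:
  assumes "finite M" "f \<notin> M"
  shows "load p (insert f M) x = load p M x + (if p f = x then 1 else 0)"
proof -
  have "{e \<in> insert f M. p e = x} = (if p f = x then insert f {e \<in> M. p e = x} else {e \<in> M. p e = x})"
    by auto
  then show ?thesis using assms by (simp add: load_def)
qed

text \<open>The lost edge is accounted for on the left, which avoids truncated subtraction;
  \<open>load_exchange\<close> has the same form.\<close>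

lemma load_remove:
  assumes "finite M" "e \<in> M"
  shows "load p (M - {e}) x + (if p e = x then 1 else 0) = load p M x"
  using load_insert[of "M - {e}" e p x] assms by (simp add: insert_absorb)

lemma load_exchange:
  assumes "finite M" "e \<in> M" "f \<notin> M"
  shows "load p (insert f (M - {e})) x + (if p e = x then 1 else 0)
    = load p M x + (if p f = x then 1 else 0)"
  using load_insert[of "M - {e}" f p x] load_remove[of M e p x] assms by simp

text \<open>Hitting is carried through all exchanges as equality of images; this recovers it from
  positive loads.\<close>

lemma image_eq_if_load_pos:
  assumes "finite E" "N \<subseteq> E" "\<And>x. x \<in> p ` E \<Longrightarrow> 0 < load p N x"
  shows "p ` N = p ` E"
  using assms load_pos_iff[OF finite_subset[OF assms(2,1)], of p] by blast

section \<open>Alternating exchanges\<close>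

lemma relievable_mono: "m \<le> n \<Longrightarrow> relievable p q E t M m \<subseteq> relievable p q E t M n"
  by (induction n) (auto simp: le_Suc_eq)

text \<open>Exchanging \<open>e\<close> for \<open>f\<close> leaves the short alternating paths
  intact. They visit only vertices relievable within \<open>n\<close> exchanges, so they never leave
  a vertex through \<open>e\<close>, the only edge lost. Exits survive as well: loads under
  \<open>q\<close> do not change, and the only load under \<open>p\<close> that can grow is that of
  \<open>p f\<close>, which is not below \<open>t\<close> anyway.\<close>

lemma relievable_exchange:
  assumes fin: "finite M" and e: "e \<in> M" and f: "f \<notin> M" and q: "q f = q e"
    and pe: "p e \<notin> relievable p q E t M n" and t: "t \<le> load p M (p f)"
  shows "m \<le> n \<Longrightarrow> relievable p q E t M m \<subseteq> relievable p q E t (insert f (M - {e})) m"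
proof (induction m)
  case 0
  let ?N = "insert f (M - {e})"
  show ?case
  proof
    fix x assume x: "x \<in> relievable p q E t M 0"
    then have ne: "x \<noteq> p e" using pe relievable_mono[of 0 n p q E t M] by auto
    have lq: "load q ?N y = load q M y" for y
      using load_exchange[OF fin e f, of q y] q by simp
    have lp: "load p ?N x < t" if "load p M x < t"
      using load_exchange[OF fin e f, of p x] ne t that by (auto split: if_splits)
    from x lp ne show "x \<in> relievable p q E t ?N 0" by (auto simp: lq)
  qed
next
  case (Suc m)
  let ?N = "insert f (M - {e})"
  have IH: "relievable p q E t M m \<subseteq> relievable p q E t ?N m" using Suc by simp
  have "relievable p q E t M (Suc m) \<subseteq> relievable p q E t M n"
    using Suc.prems by (rule relievable_mono)
  then have ne: "x \<noteq> p e" if "x \<in> relievable p q E t M (Suc m)" for x using that pe by blast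
  show ?case
  proof
    fix x assume x: "x \<in> relievable p q E t M (Suc m)"
    consider "x \<in> relievable p q E t M m"
      | d g where "d \<in> M" "g \<in> E" "p d = x" "q g = q d" "p g \<in> relievable p q E t M m"
      using x by auto
    then show "x \<in> relievable p q E t ?N (Suc m)"
    proof cases
      case 1
      then show ?thesis using IH by auto
    next
      case 2
      moreover have "d \<in> ?N" using 2 ne[OF x] by auto
      ultimately show ?thesis using IH by auto
    qed
  qed
qed

text \<open>One unit of surplus is pushed along the path. If \<open>p f\<close> lies below
  \<open>t\<close>, it absorbs the unit and the excess drops. Otherwise \<open>p f\<close> becomes
  overloaded in place of \<open>x\<close> with the excess unchanged, and its shorter path survives
  the exchange, so the induction hypothesis applies to the new edge set.\<close>

lemma relievable_reduces_excess:
  assumes fin: "finite E" and t: "0 < t"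
  shows "M \<subseteq> E \<Longrightarrow> p ` M = p ` E \<Longrightarrow> q ` M = q ` E \<Longrightarrow> t < load p M x
    \<Longrightarrow> x \<in> relievable p q E t M n
    \<Longrightarrow> \<exists>N\<subseteq>E. p ` N = p ` E \<and> q ` N = q ` E \<and> (\<forall>y. load q N y \<le> load q M y)
          \<and> excess p E t N < excess p E t M"
proof (induction n arbitrary: M x)
  case 0
  have finM: "finite M" using 0(1) fin by (rule finite_subset)
  \<comment> \<open>Since the load of \<open>x\<close> exceeds \<open>t\<close>, its exit must be an
    edge whose other end is hit twice; that edge can simply be deleted.\<close>
  obtain e where e: "e \<in> M" "p e = x" "2 \<le> load q M (q e)" using 0(4,5) by auto
  let ?N = "M - {e}"
  have lp: "load p ?N z + (if p e = z then 1 else 0) = load p M z" for z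
    by (rule load_remove[OF finM e(1)])
  have lq: "load q ?N z + (if q e = z then 1 else 0) = load q M z" for z
    by (rule load_remove[OF finM e(1)])
  have sub: "?N \<subseteq> E" using 0(1) by blast
  have "p ` ?N = p ` E"
  proof (rule image_eq_if_load_pos[OF fin sub])
    fix z assume "z \<in> p ` E"
    then have "0 < load p M z" using load_pos_iff[OF finM, of p z] 0(2) by simp
    then show "0 < load p ?N z" using lp[of z] e 0(4) t by (auto split: if_splits)
  qed
  moreover have "q ` ?N = q ` E"
  proof (rule image_eq_if_load_pos[OF fin sub])
    fix z assume "z \<in> q ` E"
    then have "0 < load q M z" using load_pos_iff[OF finM, of q z] 0(3) by simp
    then show "0 < load q ?N z" using lq[of z] e by (auto split: if_splits)
  qed
  moreover have "load q ?N y \<le> load q M y" for y using lq[of y] by simp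
  moreover have "excess p E t ?N < excess p E t M"
    unfolding excess_def
  proof (rule sum_strict_mono_ex1)
    show "finite (p ` E)" using fin by simp
    show "\<forall>z\<in>p ` E. load p ?N z - t \<le> load p M z - t"
      by (intro ballI diff_le_mono) (metis le_add1 lp)
    have "x \<in> p ` E" using e 0(1) by blast
    moreover have "load p ?N x - t < load p M x - t" using lp[of x] e 0(4) by simp
    ultimately show "\<exists>z\<in>p ` E. load p ?N z - t < load p M z - t" by blast
  qed
  ultimately show ?case using sub by blast
next
  case (Suc n)
  have finM: "finite M" using Suc.prems(1) fin by (rule finite_subset)
  show ?case
  proof (cases "x \<in> relievable p q E t M n")
    case True
    with Suc show ?thesis by blast
  next
    case False
    then obtain e f where e: "e \<in> M" "p e = x" and f: "f \<in> E" "q f = q e"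
      and pf: "p f \<in> relievable p q E t M n" using Suc.prems(5) by auto
    have ne: "p f \<noteq> x" using pf False by auto
    have "x \<notin> relievable p q E t M 0" using False relievable_mono[of 0 n p q E t M] by auto
    \<comment> \<open>Otherwise \<open>e\<close> itself would be an exit. So \<open>e\<close> is the
      only edge of \<open>M\<close> at \<open>q e\<close>, which forces \<open>f\<close> to lie
      outside \<open>M\<close>.\<close>
    then have lqe: "load q M (q e) < 2" using e by auto
    have fM: "f \<notin> M"
    proof
      assume "f \<in> M"
      then have "card {e, f} \<le> load q M (q e)" unfolding load_def
        using e f finM by (intro card_mono) auto
      moreover have "e \<noteq> f" using ne e by auto
      ultimately show False using lqe by simp
    qed
    let ?N = "insert f (M - {e})"
    have lp: "load p ?N z + (if p e = z then 1 else 0) = load p M z + (if p f = z then 1 else 0)" for z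
      by (rule load_exchange[OF finM e(1) fM])
    have lq: "load q ?N z = load q M z" for z
      using load_exchange[OF finM e(1) fM, of q z] f by simp
    have sub: "?N \<subseteq> E" using Suc.prems(1) f by blast
    have pN: "p ` ?N = p ` E"
    proof (rule image_eq_if_load_pos[OF fin sub])
      fix z assume "z \<in> p ` E"
      then have "0 < load p M z" using load_pos_iff[OF finM, of p z] Suc.prems(2) by simp
      then show "0 < load p ?N z" using lp[of z] e Suc.prems(4) t by (auto split: if_splits)
    qed
    have qN: "q ` ?N = q ` E"
    proof (rule image_eq_if_load_pos[OF fin sub])
      fix z assume "z \<in> q ` E"
      then show "0 < load q ?N z" using load_pos_iff[OF finM, of q z] Suc.prems(3) lq[of z] by simp
    qed
    have xE: "x \<in> p ` E" using e Suc.prems(1) by blast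
    show ?thesis
    proof (cases "load p M (p f) < t")
      case True
      have "excess p E t ?N < excess p E t M"
        unfolding excess_def
      proof (rule sum_strict_mono_ex1)
        show "finite (p ` E)" using fin by simp
        show "\<forall>z\<in>p ` E. load p ?N z - t \<le> load p M z - t"
        proof
          fix z
          show "load p ?N z - t \<le> load p M z - t"
            using lp[of z] True by (cases "p f = z"; cases "p e = z") auto
        qed
        have "load p ?N x - t < load p M x - t" using lp[of x] e ne Suc.prems(4) by simp
        then show "\<exists>z\<in>p ` E. load p ?N z - t < load p M z - t" using xE by blast
      qed
      then show ?thesis using sub pN qN lq by (metis order_refl)
    next
      case False
      \<comment> \<open>Both \<open>x\<close> and \<open>p f\<close> have load at least
        \<open>t\<close> before and after the exchange, so truncation has no effect there and the
        unit lost at \<open>x\<close> reappears at \<open>p f\<close>.\<close>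
      have "load p ?N z - t + (if p e = z then 1 else 0) = load p M z - t + (if p f = z then 1 else 0)" for z
        using lp[of z] False ne e Suc.prems(4) by (cases "p f = z"; cases "p e = z") auto
      then have "(\<Sum>z\<in>p ` E. load p ?N z - t + (if p e = z then 1 else 0))
          = (\<Sum>z\<in>p ` E. load p M z - t + (if p f = z then 1 else 0))" by simp
      then have ex: "excess p E t ?N = excess p E t M"
        using fin xE e f by (simp add: sum.distrib excess_def)
      have "t < load p ?N (p f)" using lp[of "p f"] ne e False by simp
      moreover have "p f \<in> relievable p q E t ?N n"
        using relievable_exchange[OF finM e(1) fM f(2), of p E t n n] pf
          \<open>x \<notin> relievable p q E t M n\<close> e(2) False by auto
      ultimately show ?thesis
        using Suc.IH[of ?N "p f"] sub pN qN by (simp add: lq ex)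
    qed
  qed
qed

text \<open>The edges \<open>D\<close> of \<open>M\<close> at the vertices \<open>R\<close> without
  exit are counted in two ways. Their ends under \<open>q\<close> are distinct and have all their
  neighbours in \<open>R\<close>, so the Hall-type condition gives at most \<open>t * card R\<close>
  edges. But each vertex of \<open>R\<close> has load at least \<open>t\<close>, and
  \<open>x\<close> has more.\<close>

lemma overloaded_relievable:
  assumes fin: "finite E" and M: "M \<subseteq> E"
    and hall: "\<And>S. S \<subseteq> q ` E \<Longrightarrow> card S \<le> t * card (p ` {e \<in> E. q e \<in> S})"
    and x: "x \<in> p ` E" "t < load p M x"
  shows "\<exists>n. x \<in> relievable p q E t M n"
proof (rule ccontr)
  assume no: "\<nexists>n. x \<in> relievable p q E t M n"
  have finM: "finite M" using M fin by (rule finite_subset)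
  define R where "R = p ` E - (\<Union>n. relievable p q E t M n)"
  define D where "D = {e \<in> M. p e \<in> R}"
  have xR: "x \<in> R" using no x by (auto simp: R_def)
  have finR: "finite R" using fin by (simp add: R_def)
  have out0: "z \<notin> relievable p q E t M n" if "z \<in> R" for z n using that by (auto simp: R_def)
  have low: "t \<le> load p M z" if "z \<in> R" for z using out0[OF that, of 0] by auto
  have single: "load q M (q e) < 2" if "e \<in> D" for e
    using out0[of "p e" 0] that by (auto simp: D_def)
  have inj: "inj_on q D"
  proof (rule inj_onI, rule ccontr)
    fix e f assume ef: "e \<in> D" "f \<in> D" "q e = q f" "e \<noteq> f"
    then have "card {e, f} \<le> load q M (q e)" unfolding load_def
      using finM by (intro card_mono) (auto simp: D_def)
    then show False using single[of e] ef by simp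
  qed
  \<comment> \<open>A relievable neighbour would give \<open>p e\<close> a path with one more
    exchange.\<close>
  have "p ` {f \<in> E. q f \<in> q ` D} \<subseteq> R"
  proof
    fix z assume "z \<in> p ` {f \<in> E. q f \<in> q ` D}"
    then obtain f e where fe: "f \<in> E" "e \<in> M" "p e \<in> R" "q f = q e" "z = p f"
      by (auto simp: D_def)
    have "z \<notin> relievable p q E t M n" for n
    proof
      assume "z \<in> relievable p q E t M n"
      then have "p e \<in> relievable p q E t M (Suc n)" using fe by auto
      then show False using out0 fe(3) by blast
    qed
    then show "z \<in> R" using fe by (auto simp: R_def)
  qed
  then have "card (p ` {f \<in> E. q f \<in> q ` D}) \<le> card R" using finR by (rule card_mono[rotated])
  moreover have "q ` D \<subseteq> q ` E" using M by (auto simp: D_def)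
  ultimately have "card (q ` D) \<le> t * card R" using hall[of "q ` D"] by (meson le_trans mult_le_mono2)
  then have "card D \<le> t * card R" by (simp add: card_image[OF inj])
  moreover have "card D = (\<Sum>z\<in>R. load p M z)"
  proof -
    have "D = (\<Union>z\<in>R. {e \<in> M. p e = z})" by (auto simp: D_def)
    also have "card \<dots> = (\<Sum>z\<in>R. card {e \<in> M. p e = z})"
      using finM finR by (intro card_UN_disjoint) auto
    finally show ?thesis by (simp add: load_def)
  qed
  moreover have "(\<Sum>z\<in>R. t) < (\<Sum>z\<in>R. load p M z)"
    using finR low xR x(2) by (intro sum_strict_mono_ex1) auto
  ultimately show False by (simp add: mult.commute)
qed

text \<open>The bound on the loads under \<open>q\<close> is what allows a second application with
  \<open>p\<close> and \<open>q\<close> swapped without spoiling the first.\<close>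

lemma shallow_on_one_side:
  assumes fin: "finite E" and t: "0 < t"
    and hall: "\<And>S. S \<subseteq> q ` E \<Longrightarrow> card S \<le> t * card (p ` {e \<in> E. q e \<in> S})"
    and M: "M \<subseteq> E" "p ` M = p ` E" "q ` M = q ` E"
  shows "\<exists>N\<subseteq>E. p ` N = p ` E \<and> q ` N = q ` E \<and> (\<forall>y. load q N y \<le> load q M y)
    \<and> (\<forall>x\<in>p ` E. load p N x \<le> t)"
  using M
proof (induction "excess p E t M" arbitrary: M rule: less_induct)
  case less
  show ?case
  proof (cases "\<forall>x\<in>p ` E. load p M x \<le> t")
    case True
    then show ?thesis using less.prems by (intro exI[of _ M]) simp
  next
    case False
    then obtain x where x: "x \<in> p ` E" "t < load p M x" by (auto simp: not_le)
    have "\<exists>n. x \<in> relievable p q E t M n"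
      by (rule overloaded_relievable) (fact fin less.prems x hall)+
    then obtain n where n: "x \<in> relievable p q E t M n" ..
    obtain M' where M': "M' \<subseteq> E" "p ` M' = p ` E" "q ` M' = q ` E"
      "\<forall>y. load q M' y \<le> load q M y" "excess p E t M' < excess p E t M"
      using relievable_reduces_excess[OF fin t less.prems x(2) n] by (elim exE conjE)
    obtain N where N: "N \<subseteq> E" "p ` N = p ` E" "q ` N = q ` E"
      "\<forall>y. load q N y \<le> load q M' y" "\<forall>x\<in>p ` E. load p N x \<le> t"
      using less.hyps[OF M'(5,1,2,3)] by (elim exE conjE)
    have "\<forall>y. load q N y \<le> load q M y" using N(4) M'(4) by (metis le_trans)
    with N show ?thesis by (intro exI[of _ N] conjI)
  qed
qed

section \<open>From minimum degrees to the Hall-type condition\<close>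

lemma hall_condition_of_degrees:
  assumes fin: "finite X" "finite Y" "finite E" and parts: "p ` E \<subseteq> X" "q ` E \<subseteq> Y"
    and dX: "\<And>x. x \<in> X \<Longrightarrow> dX \<le> card (q ` {e \<in> E. p e = x})"
    and dY: "\<And>y. y \<in> Y \<Longrightarrow> dY \<le> card (p ` {e \<in> E. q e = y})"
    and le: "card Y \<le> t * card X" "card Y \<le> dX + t * dY"
    and S: "S \<subseteq> Y"
  shows "card S \<le> t * card (p ` {e \<in> E. q e \<in> S})"
proof (cases "S = {}")
  case False
  let ?N = "p ` {e \<in> E. q e \<in> S}"
  have finN: "finite ?N" using fin by simp
  have NX: "?N \<subseteq> X" using parts by blast
  show ?thesis
  proof (cases "?N = X")
    case True
    then show ?thesis using le(1) card_mono[OF fin(2) S] by simp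
  next
    case ne: False
    \<comment> \<open>A vertex \<open>x\<close> with no neighbour in \<open>S\<close> has its at
      least \<open>dX\<close> neighbours in \<open>Y - S\<close>, so \<open>card S\<close> is at
      most \<open>card Y - dX\<close>, hence at most \<open>t * dY\<close>. A single vertex of
      \<open>S\<close> already has \<open>dY\<close> neighbours in \<open>?N\<close>.\<close>
    then obtain x where x: "x \<in> X" "x \<notin> ?N" using NX by blast
    have "q ` {e \<in> E. p e = x} \<subseteq> Y - S" using x parts by auto
    then have "dX \<le> card (Y - S)" using dX[OF x(1)] card_mono[of "Y - S"] fin(2)
      by (meson finite_Diff le_trans)
    then have a: "dX + card S \<le> card Y"
      using S fin(2) card_mono[OF fin(2) S] finite_subset[OF S fin(2)] by (simp add: card_Diff_subset)
    obtain y where y: "y \<in> S" using False by blast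
    have "p ` {e \<in> E. q e = y} \<subseteq> ?N" using y by auto
    then have "dY \<le> card ?N" using dY[of y] y S card_mono[OF finN] by (meson le_trans subsetD)
    then have "t * dY \<le> t * card ?N" by simp
    then show ?thesis using a le(2) by linarith
  qed
qed simp

lemma min_degree_le:
  assumes "finite X" "x \<in> X" "{u. \<exists>e\<in>E. ends e = {u, x}} = N"
  shows "min_degree ends E X \<le> card N"
proof -
  have "min_degree ends E X \<le> simple_deg ends E x"
    unfolding min_degree_def using assms(1,2) by (intro Min_le) auto
  then show ?thesis by (simp only: simple_deg_def assms(3))
qed

section \<open>Treating both parts of the bipartite graph\<close>

theorem theorem4p6:
  fixes A B :: "'v set" and E :: "'e set" and ends :: "'e \<Rightarrow> 'v set" and t :: nat
  assumes "t > 0"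
    and "bipartite_multigraph A B E ends"
    and "card A \<le> card B" and "card B \<le> t * card A"
    and "t * min_degree ends E A + min_degree ends E B \<ge> card A"
    and "min_degree ends E A + t * min_degree ends E B \<ge> card B"
  shows "\<exists>M\<subseteq>E. hitting ends (A \<union> B) M \<and> shallow t ends (A \<union> B) M"
proof -
  interpret bipartite_multigraph A B E ends by fact
  have fin: "finite A" "finite B" "finite E" using finite_vertices finite_edges by auto
  have "\<exists>a b. a \<in> A \<and> b \<in> B \<and> ends e = {a, b}" if e: "e \<in> E" for e
  proof -
    obtain a b where ab: "a \<in> A" "a \<in> ends e" "b \<in> B" "b \<in> ends e"
      using edge_meets_parts[OF e] by blast
    then have "a \<noteq> b" using disjoint_parts by blast
    then have "{a, b} = ends e"
      using ab card_ends[OF e] by (intro card_subset_eq) (auto intro: card_ge_0_finite)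
    then show ?thesis using ab by metis
  qed
  \<comment> \<open>Pairing the two ends lets one choice function yield both projections.\<close>
  then have "\<forall>e\<in>E. \<exists>c. fst c \<in> A \<and> snd c \<in> B \<and> ends e = {fst c, snd c}" by fastforce
  then obtain c where c: "\<forall>e\<in>E. fst (c e) \<in> A \<and> snd (c e) \<in> B \<and> ends e = {fst (c e), snd (c e)}"
    unfolding bchoice_iff by (elim exE)
  define p q where "p = fst \<circ> c" and "q = snd \<circ> c"
  with c have pq: "p e \<in> A" "q e \<in> B" "ends e = {p e, q e}" if "e \<in> E" for e
    using that by auto
  have degA: "deg ends M a = load p M a" if "a \<in> A" "M \<subseteq> E" for M a
  proof -
    have "a \<in> ends e \<longleftrightarrow> p e = a" if "e \<in> M" for e
      using pq[OF subsetD[OF \<open>M \<subseteq> E\<close> that]] \<open>a \<in> A\<close> disjoint_parts by auto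
    then have "{e \<in> M. a \<in> ends e} = {e \<in> M. p e = a}" by auto
    then show ?thesis by (simp add: deg_def load_def)
  qed
  have degB: "deg ends M b = load q M b" if "b \<in> B" "M \<subseteq> E" for M b
  proof -
    have "b \<in> ends e \<longleftrightarrow> q e = b" if "e \<in> M" for e
      using pq[OF subsetD[OF \<open>M \<subseteq> E\<close> that]] \<open>b \<in> B\<close> disjoint_parts by auto
    then have "{e \<in> M. b \<in> ends e} = {e \<in> M. q e = b}" by auto
    then show ?thesis by (simp add: deg_def load_def)
  qed
  have dA: "min_degree ends E A \<le> card (q ` {e \<in> E. p e = a})" if a: "a \<in> A" for a
  proof (rule min_degree_le[OF fin(1) a])
    have "ends e = {u, a} \<longleftrightarrow> p e = a \<and> u = q e" if "e \<in> E" for e u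
      using pq[OF that] a disjoint_parts by (auto simp: doubleton_eq_iff)
    then show "{u. \<exists>e\<in>E. ends e = {u, a}} = q ` {e \<in> E. p e = a}" by auto
  qed
  have dB: "min_degree ends E B \<le> card (p ` {e \<in> E. q e = b})" if b: "b \<in> B" for b
  proof (rule min_degree_le[OF fin(2) b])
    have "ends e = {u, b} \<longleftrightarrow> q e = b \<and> u = p e" if "e \<in> E" for e u
      using pq[OF that] b disjoint_parts by (auto simp: doubleton_eq_iff)
    then show "{u. \<exists>e\<in>E. ends e = {u, b}} = p ` {e \<in> E. q e = b}" by auto
  qed
  have parts: "p ` E \<subseteq> A" "q ` E \<subseteq> B" using pq by auto
  have hallB: "card S \<le> t * card (p ` {e \<in> E. q e \<in> S})" if "S \<subseteq> B" for S
    by (rule hall_condition_of_degrees) (fact fin parts dA dB assms(4,6) that)+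
  have "card B \<le> t * card B" using \<open>t > 0\<close> by simp
  then have cA: "card A \<le> t * card B" using assms(3) by linarith
  have mA: "card A \<le> min_degree ends E B + t * min_degree ends E A" using assms(5) by simp
  have hallA: "card S \<le> t * card (q ` {e \<in> E. p e \<in> S})" if "S \<subseteq> A" for S
    by (rule hall_condition_of_degrees) (fact fin parts dA dB cA mA that)+
  \<comment> \<open>The Hall-type condition for singletons excludes isolated vertices, so hitting
    becomes equality of images with those of \<open>E\<close>.\<close>
  have "a \<in> p ` E" if "a \<in> A" for a
  proof (rule ccontr)
    assume "a \<notin> p ` E"
    then have no: "{e \<in> E. p e \<in> {a}} = {}" by auto
    have "card {a} \<le> t * card (q ` {e \<in> E. p e \<in> {a}})" by (rule hallA) (simp add: that)
    then show False unfolding no by simp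
  qed
  then have pE: "p ` E = A" using parts by blast
  have "b \<in> q ` E" if "b \<in> B" for b
  proof (rule ccontr)
    assume "b \<notin> q ` E"
    then have no: "{e \<in> E. q e \<in> {b}} = {}" by auto
    have "card {b} \<le> t * card (p ` {e \<in> E. q e \<in> {b}})" by (rule hallB) (simp add: that)
    then show False unfolding no by simp
  qed
  then have qE: "q ` E = B" using parts by blast
  \<comment> \<open>The first run starts from the full edge set and bounds the degrees in
    \<open>A\<close>.\<close>
  have "\<exists>M\<subseteq>E. p ` M = p ` E \<and> q ` M = q ` E \<and> (\<forall>y. load q M y \<le> load q E y)
      \<and> (\<forall>x\<in>p ` E. load p M x \<le> t)"
    by (rule shallow_on_one_side) (use fin \<open>t > 0\<close> hallB qE in simp_all)
  then obtain M where M: "M \<subseteq> E" "p ` M = p ` E" "q ` M = q ` E" "\<forall>x\<in>p ` E. load p M x \<le> t"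
    by (elim exE conjE)
  \<comment> \<open>The second run starts from \<open>M\<close> with the parts swapped; it does not
    raise loads in \<open>A\<close>, so the bound obtained there persists.\<close>
  have "\<exists>N\<subseteq>E. q ` N = q ` E \<and> p ` N = p ` E \<and> (\<forall>x. load p N x \<le> load p M x)
      \<and> (\<forall>y\<in>q ` E. load q N y \<le> t)"
    by (rule shallow_on_one_side) (use fin \<open>t > 0\<close> hallA pE M in simp_all)
  then obtain N where N: "N \<subseteq> E" "q ` N = q ` E" "p ` N = p ` E"
    "\<forall>x. load p N x \<le> load p M x" "\<forall>y\<in>q ` E. load q N y \<le> t"
    by (elim exE conjE)
  have finN: "finite N" using N(1) fin(3) by (rule finite_subset)
  have "hitting ends (A \<union> B) N"
    unfolding hitting_def
  proof
    fix v assume "v \<in> A \<union> B"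
    then show "1 \<le> deg ends N v"
    proof
      assume "v \<in> A"
      then show ?thesis
        using degA[of v N] load_pos_iff[OF finN, of p v] N(1,3) pE by simp
    next
      assume "v \<in> B"
      then show ?thesis
        using degB[of v N] load_pos_iff[OF finN, of q v] N(1,2) qE by simp
    qed
  qed
  moreover have "shallow t ends (A \<union> B) N"
    unfolding shallow_def
  proof
    fix v assume "v \<in> A \<union> B"
    then show "deg ends N v \<le> t"
    proof
      assume "v \<in> A"
      then have "load p M v \<le> t" using M(4) pE by simp
      then show ?thesis using degA[OF \<open>v \<in> A\<close> N(1)] N(4) by (metis le_trans)
    next
      assume "v \<in> B"
      then show ?thesis using degB[OF _ N(1)] N(5) qE by simp
    qed
  qed
  ultimately show ?thesis using N(1) by blast
qed

end
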